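(* Let $\mathsf{JL}$ be any justification logic from the list in the context and $\mathsf{CS}$ a constant specification for $\mathsf{JL}$. Every sequent derivable in $\mathsf{G3JL}_{\mathsf{CS}}$ has a derivation with the sublabel property; in other words, every derivable sequent $\Gamma\Rightarrow\Delta$ has a derivation in which all labels are eigenlabels or labels in $\Gamma\cup\Delta$.
   Context: Justification logics. Terms are built from justification variables and constants by binary $\cdot,+$ and (depending on the logic) unary $!$, $?$, $\bar{?}$. Formulas are built from propositional variables and $\bot$ by $\neg,\wedge,\vee,\to$ and $t:A$. $\mathsf J$ has axiom schemes: propositional tautologies; $s:A\to(s+t):A$, $s:A\to(t+s):A$; $s:(A\to B)\to(t:A\to(s\cdot t):B)$. A justification logic $\mathsf{JL}$ is $\mathsf J$ extended by at most one of (jT) $t:A\to A$, (jD) $t:\bot\to\bot$, and by any subset of (j4) $t:A\to\,!t:t:A$, (jB) $\neg A\to\bar{?}t:\neg t:A$, (j5) $\neg t:A\to\,?t:\neg t:A$; its language contains $!$ (resp. $\bar{?}$, $?$) exactly when (j4) (resp. (jB), (j5)) is an axiom. A constant specification $\mathsf{CS}$ for $\mathsf{JL}$: if (j4) is not an axiom, a set of formulas $c_n:\dots:c_1:A$ ($n\ge1$, $c_j$ constants, $A$ an axiom instance), closed under passing from $c_n:c_{n-1}:\dots:c_1:A$ to $c_{n-1}:\dots:c_1:A$; if (j4) is an axiom, a set of formulas $c:A$ ($c$ a constant, $A$ an axiom instance). Calculus $\mathsf{G3JL}_{\mathsf{CS}}$. Fix a countably infinite set of labels $w,v,u,\dots$.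 The labeled language has labeled formulas $w\Vvdash A$, relational atoms $wRv$ and evidence atoms $wE(t,A)$ ($A$ a formula, $t$ a term). Sequents $\Gamma\Rightarrow\Delta$ consist of finite multisets of these. Initial sequents: $w\Vvdash P,\Gamma\Rightarrow\Delta,w\Vvdash P$ ($P$ a propositional variable); $w\Vvdash\bot,\Gamma\Rightarrow\Delta$; $wRv,\Gamma\Rightarrow\Delta,wRv$; $wE(t,A),\Gamma\Rightarrow\Delta,wE(t,A)$. Rules (premises / conclusion): (L$\neg$) $\Gamma\Rightarrow\Delta,w\Vvdash A$ / $w\Vvdash\neg A,\Gamma\Rightarrow\Delta$; (R$\neg$) $w\Vvdash A,\Gamma\Rightarrow\Delta$ / $\Gamma\Rightarrow\Delta,w\Vvdash\neg A$; (L$\wedge$) $w\Vvdash A,w\Vvdash B,\Gamma\Rightarrow\Delta$ / $w\Vvdash A\wedge B,\Gamma\Rightarrow\Delta$; (R$\wedge$) $\Gamma\Rightarrow\Delta,w\Vvdash A$ and $\Gamma\Rightarrow\Delta,w\Vvdash B$ / $\Gamma\Rightarrow\Delta,w\Vvdash A\wedge B$; (L$\vee$) $w\Vvdash A,\Gamma\Rightarrow\Delta$ and $w\Vvdash B,\Gamma\Rightarrow\Delta$ / $w\Vvdash A\vee B,\Gamma\Rightarrow\Delta$; (R$\vee$) $\Gamma\Rightarrow\Delta,w\Vvdash A,w\Vvdash B$ / $\Gamma\Rightarrow\Delta,w\Vvdash A\vee B$; (L$\to$) $\Gamma\Rightarrow\Delta,w\Vvdash A$ and $w\Vvdash B,\Gamma\Rightarrow\Delta$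 / $w\Vvdash A\to B,\Gamma\Rightarrow\Delta$; (R$\to$) $w\Vvdash A,\Gamma\Rightarrow\Delta,w\Vvdash B$ / $\Gamma\Rightarrow\Delta,w\Vvdash A\to B$; (L:) $v\Vvdash A,w\Vvdash t:A,wRv,\Gamma\Rightarrow\Delta$ / $w\Vvdash t:A,wRv,\Gamma\Rightarrow\Delta$; (R:) $wRv,wE(t,A),\Gamma\Rightarrow\Delta,v\Vvdash A$ / $wE(t,A),\Gamma\Rightarrow\Delta,w\Vvdash t:A$, where the eigenlabel $v$ does not occur in the conclusion; (E) $wE(t,A),w\Vvdash t:A,\Gamma\Rightarrow\Delta$ / $w\Vvdash t:A,\Gamma\Rightarrow\Delta$; (El+) $wE(s+t,A),wE(t,A),\Gamma\Rightarrow\Delta$ / $wE(t,A),\Gamma\Rightarrow\Delta$; (Er+) $wE(t+s,A),wE(t,A),\Gamma\Rightarrow\Delta$ / $wE(t,A),\Gamma\Rightarrow\Delta$; (E$\cdot$) $wE(s\cdot t,B),wE(s,A\to B),wE(t,A),\Gamma\Rightarrow\Delta$ / $wE(s,A\to B),wE(t,A),\Gamma\Rightarrow\Delta$; (IAN)/(AN) $wE(c,F),\Gamma\Rightarrow\Delta$ / $\Gamma\Rightarrow\Delta$, for $c:F\in\mathsf{CS}$ ($c$ a constant). If (jT) is an axiom: (Ref) $wRw,\Gamma\Rightarrow\Delta$ / $\Gamma\Rightarrow\Delta$. If (jD) is an axiom: (Ser) $wRv,\Gamma\Rightarrow\Delta$ / $\Gamma\Rightarrow\Delta$, where the eigenlabel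 $v$ does not occur in the conclusion. If (j4) is an axiom: (E!) $wE(!t,t:A),wE(t,A),\Gamma\Rightarrow\Delta$ / $wE(t,A),\Gamma\Rightarrow\Delta$; (Mon) $vE(t,A),wE(t,A),wRv,\Gamma\Rightarrow\Delta$ / $wE(t,A),wRv,\Gamma\Rightarrow\Delta$; (Trans) $wRu,wRv,vRu,\Gamma\Rightarrow\Delta$ / $wRv,vRu,\Gamma\Rightarrow\Delta$. If (jB) is an axiom: (E$\bar{?}$) $w\Vvdash A,\Gamma\Rightarrow\Delta$ and $wE(\bar{?}t,\neg t:A),\Gamma\Rightarrow\Delta$ / $\Gamma\Rightarrow\Delta$; (Sym) $vRw,wRv,\Gamma\Rightarrow\Delta$ / $wRv,\Gamma\Rightarrow\Delta$. If (j5) is an axiom: (SE) $w\Vvdash t:A,wE(t,A),\Gamma\Rightarrow\Delta$ / $wE(t,A),\Gamma\Rightarrow\Delta$; (E?) $wE(t,A),\Gamma\Rightarrow\Delta$ and $wE(?t,\neg t:A),\Gamma\Rightarrow\Delta$ / $\Gamma\Rightarrow\Delta$. A rule instance has the sublabel property if every label occurring in any premise is either an eigenlabel (of an instance of (R:) or (Ser)) or occurs in the conclusion. A derivation has the sublabel property if all rule instances in it do. *)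

theory Defs
  imports "HOL-Library.Multiset"
begin

section \<open>Justification logics\<close>

text \<open>The type variables \<open>'p\<close>, \<open>'x\<close>, \<open>'c\<close> stand for the propositional variables, the justification
  variables and the justification constants.\<close>

datatype ('x, 'c) tm =
    JVar 'x
  | JConst 'c
  | App "('x, 'c) tm" "('x, 'c) tm"
  | Plus "('x, 'c) tm" "('x, 'c) tm"
  | Bang "('x, 'c) tm"
  | Quest "('x, 'c) tm"
  | BarQuest "('x, 'c) tm"

datatype ('p, 'x, 'c) fm =
    PVar 'p
  | Bot
  | Neg "('p, 'x, 'c) fm"
  | Conj "('p, 'x, 'c) fm" "('p, 'x, 'c) fm"
  | Disj "('p, 'x, 'c) fm" "('p, 'x, 'c) fm"
  | Imp "('p, 'x, 'c) fm" "('p, 'x, 'c) fm"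
  | Just "('x, 'c) tm" "('p, 'x, 'c) fm"

text \<open>A logic is given by the set of axiom schemes it adds to J.\<close>

datatype scheme = jT | jD | j4 | jB | j5

definition justification_logic :: "scheme set \<Rightarrow> bool" where
  "justification_logic L \<longleftrightarrow> \<not> (jT \<in> L \<and> jD \<in> L)"

text \<open>The types contain all operations; the language of a particular logic is carved out by a
  predicate.\<close>

fun lang_tm :: "scheme set \<Rightarrow> ('x, 'c) tm \<Rightarrow> bool" where
  "lang_tm L (JVar x) \<longleftrightarrow> True"
| "lang_tm L (JConst c) \<longleftrightarrow> True"
| "lang_tm L (App s t) \<longleftrightarrow> lang_tm L s \<and> lang_tm L t"
| "lang_tm L (Plus s t) \<longleftrightarrow> lang_tm L s \<and> lang_tm L t"
| "lang_tm L (Bang t) \<longleftrightarrow> j4 \<in> L \<and> lang_tm L t"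
| "lang_tm L (Quest t) \<longleftrightarrow> j5 \<in> L \<and> lang_tm L t"
| "lang_tm L (BarQuest t) \<longleftrightarrow> jB \<in> L \<and> lang_tm L t"

fun lang_fm :: "scheme set \<Rightarrow> ('p, 'x, 'c) fm \<Rightarrow> bool" where
  "lang_fm L (PVar p) \<longleftrightarrow> True"
| "lang_fm L Bot \<longleftrightarrow> True"
| "lang_fm L (Neg A) \<longleftrightarrow> lang_fm L A"
| "lang_fm L (Conj A B) \<longleftrightarrow> lang_fm L A \<and> lang_fm L B"
| "lang_fm L (Disj A B) \<longleftrightarrow> lang_fm L A \<and> lang_fm L B"
| "lang_fm L (Imp A B) \<longleftrightarrow> lang_fm L A \<and> lang_fm L B"
| "lang_fm L (Just t A) \<longleftrightarrow> lang_tm L t \<and> lang_fm L A"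

text \<open>For tautologies, formulas \<open>Just t A\<close> count as propositional atoms.\<close>

fun tval :: "(('p, 'x, 'c) fm \<Rightarrow> bool) \<Rightarrow> ('p, 'x, 'c) fm \<Rightarrow> bool" where
  "tval v (PVar p) \<longleftrightarrow> v (PVar p)"
| "tval v Bot \<longleftrightarrow> False"
| "tval v (Neg A) \<longleftrightarrow> \<not> tval v A"
| "tval v (Conj A B) \<longleftrightarrow> tval v A \<and> tval v B"
| "tval v (Disj A B) \<longleftrightarrow> tval v A \<or> tval v B"
| "tval v (Imp A B) \<longleftrightarrow> (tval v A \<longrightarrow> tval v B)"
| "tval v (Just t A) \<longleftrightarrow> v (Just t A)"

definition tautology :: "('p, 'x, 'c) fm \<Rightarrow> bool" where
  "tautology A \<longleftrightarrow> (\<forall>v. tval v A)"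

inductive scheme_instance :: "scheme set \<Rightarrow> ('p, 'x, 'c) fm \<Rightarrow> bool" for L where
  "tautology A \<Longrightarrow> scheme_instance L A"
| "scheme_instance L (Imp (Just s A) (Just (Plus s t) A))"
| "scheme_instance L (Imp (Just s A) (Just (Plus t s) A))"
| "scheme_instance L (Imp (Just s (Imp A B)) (Imp (Just t A) (Just (App s t) B)))"
| "jT \<in> L \<Longrightarrow> scheme_instance L (Imp (Just t A) A)"
| "jD \<in> L \<Longrightarrow> scheme_instance L (Imp (Just t Bot) Bot)"
| "j4 \<in> L \<Longrightarrow> scheme_instance L (Imp (Just t A) (Just (Bang t) (Just t A)))"
| "jB \<in> L \<Longrightarrow> scheme_instance L (Imp (Neg A) (Just (BarQuest t) (Neg (Just t A))))"
| "j5 \<in> L \<Longrightarrow> scheme_instance L (Imp (Neg (Just t A)) (Just (Quest t) (Neg (Just t A))))"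

definition axiom_instance :: "scheme set \<Rightarrow> ('p, 'x, 'c) fm \<Rightarrow> bool" where
  "axiom_instance L A \<longleftrightarrow> scheme_instance L A \<and> lang_fm L A"

text \<open>\<open>const_prefix [c\<^sub>n, \<dots>, c\<^sub>1] A\<close> is the formula \<open>c\<^sub>n : \<dots> : c\<^sub>1 : A\<close>.\<close>

definition const_prefix :: "'c list \<Rightarrow> ('p, 'x, 'c) fm \<Rightarrow> ('p, 'x, 'c) fm" where
  "const_prefix cs A = foldr (\<lambda>c. Just (JConst c)) cs A"

definition constant_specification :: "scheme set \<Rightarrow> ('p, 'x, 'c) fm set \<Rightarrow> bool" where
  "constant_specification L CS \<longleftrightarrow>
    (if j4 \<in> L
     then \<forall>F\<in>CS. \<exists>c A. axiom_instance L A \<and> F = Just (JConst c) A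
     else (\<forall>F\<in>CS. \<exists>cs A. cs \<noteq> [] \<and> axiom_instance L A \<and> F = const_prefix cs A) \<and>
          (\<forall>c cs A. cs \<noteq> [] \<and> axiom_instance L A \<and> const_prefix (c # cs) A \<in> CS
                     \<longrightarrow> const_prefix cs A \<in> CS))"


section \<open>The labeled sequent calculus G3JL\<close>

type_synonym label = nat

datatype ('p, 'x, 'c) lfm =
    Forces label "('p, 'x, 'c) fm"
  | Rel label label
  | Ev label "('x, 'c) tm" "('p, 'x, 'c) fm"

datatype ('p, 'x, 'c) sequent =
  Seq "('p, 'x, 'c) lfm multiset" "('p, 'x, 'c) lfm multiset"  (infix \<open>\<turnstile>\<close> 50)

fun labels_lfm :: "('p, 'x, 'c) lfm \<Rightarrow> label set" where
  "labels_lfm (Forces w A) = {w}"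
| "labels_lfm (Rel w v) = {w, v}"
| "labels_lfm (Ev w t A) = {w}"

fun labels_seq :: "('p, 'x, 'c) sequent \<Rightarrow> label set" where
  "labels_seq (\<Gamma> \<turnstile> \<Delta>) = (\<Union>\<phi> \<in> set_mset \<Gamma> \<union> set_mset \<Delta>. labels_lfm \<phi>)"

fun lang_lfm :: "scheme set \<Rightarrow> ('p, 'x, 'c) lfm \<Rightarrow> bool" where
  "lang_lfm L (Forces w A) \<longleftrightarrow> lang_fm L A"
| "lang_lfm L (Rel w v) \<longleftrightarrow> True"
| "lang_lfm L (Ev w t A) \<longleftrightarrow> lang_tm L t \<and> lang_fm L A"

fun lang_seq :: "scheme set \<Rightarrow> ('p, 'x, 'c) sequent \<Rightarrow> bool" where
  "lang_seq L (\<Gamma> \<turnstile> \<Delta>) \<longleftrightarrow> (\<forall>\<phi> \<in> set_mset \<Gamma> \<union> set_mset \<Delta>. lang_lfm L \<phi>)"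

text \<open>\<open>rule_instance L CS e Ps S\<close>: the list of premises \<open>Ps\<close> and the conclusion \<open>S\<close> form an instance
  of an initial sequent (\<open>Ps = []\<close>) or of a rule; \<open>e\<close> is its eigenlabel, if the rule has one.
  In \<open>Ser\<close> the label \<open>w\<close> need not occur in the conclusion, and \<open>w = v\<close> is not excluded;
  the only side condition is that \<open>v\<close> does not occur in the conclusion.
  \<open>AN\<close> is also the rule IAN: which of the two it is depends only on the shape of \<open>CS\<close>.\<close>

inductive rule_instance ::
  "scheme set \<Rightarrow> ('p, 'x, 'c) fm set \<Rightarrow> label option \<Rightarrow> ('p, 'x, 'c) sequent list
    \<Rightarrow> ('p, 'x, 'c) sequent \<Rightarrow> bool"
  for L CS where
  InitP: "rule_instance L CS None [] ({#Forces w (PVar P)#} + \<Gamma> \<turnstile> \<Delta> + {#Forces w (PVar P)#})"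
| InitBot: "rule_instance L CS None [] ({#Forces w Bot#} + \<Gamma> \<turnstile> \<Delta>)"
| InitR: "rule_instance L CS None [] ({#Rel w v#} + \<Gamma> \<turnstile> \<Delta> + {#Rel w v#})"
| InitE: "rule_instance L CS None [] ({#Ev w t A#} + \<Gamma> \<turnstile> \<Delta> + {#Ev w t A#})"
| LNeg: "rule_instance L CS None
    [\<Gamma> \<turnstile> \<Delta> + {#Forces w A#}]
    ({#Forces w (Neg A)#} + \<Gamma> \<turnstile> \<Delta>)"
| RNeg: "rule_instance L CS None
    [{#Forces w A#} + \<Gamma> \<turnstile> \<Delta>]
    (\<Gamma> \<turnstile> \<Delta> + {#Forces w (Neg A)#})"
| LConj: "rule_instance L CS None
    [{#Forces w A, Forces w B#} + \<Gamma> \<turnstile> \<Delta>]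
    ({#Forces w (Conj A B)#} + \<Gamma> \<turnstile> \<Delta>)"
| RConj: "rule_instance L CS None
    [\<Gamma> \<turnstile> \<Delta> + {#Forces w A#}, \<Gamma> \<turnstile> \<Delta> + {#Forces w B#}]
    (\<Gamma> \<turnstile> \<Delta> + {#Forces w (Conj A B)#})"
| LDisj: "rule_instance L CS None
    [{#Forces w A#} + \<Gamma> \<turnstile> \<Delta>, {#Forces w B#} + \<Gamma> \<turnstile> \<Delta>]
    ({#Forces w (Disj A B)#} + \<Gamma> \<turnstile> \<Delta>)"
| RDisj: "rule_instance L CS None
    [\<Gamma> \<turnstile> \<Delta> + {#Forces w A, Forces w B#}]
    (\<Gamma> \<turnstile> \<Delta> + {#Forces w (Disj A B)#})"
| LImp: "rule_instance L CS None
    [\<Gamma> \<turnstile> \<Delta> + {#Forces w A#}, {#Forces w B#} + \<Gamma> \<turnstile> \<Delta>]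
    ({#Forces w (Imp A B)#} + \<Gamma> \<turnstile> \<Delta>)"
| RImp: "rule_instance L CS None
    [{#Forces w A#} + \<Gamma> \<turnstile> \<Delta> + {#Forces w B#}]
    (\<Gamma> \<turnstile> \<Delta> + {#Forces w (Imp A B)#})"
| LJust: "rule_instance L CS None
    [{#Forces v A, Forces w (Just t A), Rel w v#} + \<Gamma> \<turnstile> \<Delta>]
    ({#Forces w (Just t A), Rel w v#} + \<Gamma> \<turnstile> \<Delta>)"
| RJust: "v \<notin> labels_seq ({#Ev w t A#} + \<Gamma> \<turnstile> \<Delta> + {#Forces w (Just t A)#}) \<Longrightarrow>
    rule_instance L CS (Some v)
    [{#Rel w v, Ev w t A#} + \<Gamma> \<turnstile> \<Delta> + {#Forces v A#}]
    ({#Ev w t A#} + \<Gamma> \<turnstile> \<Delta> + {#Forces w (Just t A)#})"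
| E: "rule_instance L CS None
    [{#Ev w t A, Forces w (Just t A)#} + \<Gamma> \<turnstile> \<Delta>]
    ({#Forces w (Just t A)#} + \<Gamma> \<turnstile> \<Delta>)"
| ElPlus: "rule_instance L CS None
    [{#Ev w (Plus s t) A, Ev w t A#} + \<Gamma> \<turnstile> \<Delta>]
    ({#Ev w t A#} + \<Gamma> \<turnstile> \<Delta>)"
| ErPlus: "rule_instance L CS None
    [{#Ev w (Plus t s) A, Ev w t A#} + \<Gamma> \<turnstile> \<Delta>]
    ({#Ev w t A#} + \<Gamma> \<turnstile> \<Delta>)"
| EApp: "rule_instance L CS None
    [{#Ev w (App s t) B, Ev w s (Imp A B), Ev w t A#} + \<Gamma> \<turnstile> \<Delta>]
    ({#Ev w s (Imp A B), Ev w t A#} + \<Gamma> \<turnstile> \<Delta>)"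
| AN: "Just (JConst c) F \<in> CS \<Longrightarrow> rule_instance L CS None
    [{#Ev w (JConst c) F#} + \<Gamma> \<turnstile> \<Delta>]
    (\<Gamma> \<turnstile> \<Delta>)"
| Ref: "jT \<in> L \<Longrightarrow> rule_instance L CS None
    [{#Rel w w#} + \<Gamma> \<turnstile> \<Delta>]
    (\<Gamma> \<turnstile> \<Delta>)"
| Ser: "jD \<in> L \<Longrightarrow> v \<notin> labels_seq (\<Gamma> \<turnstile> \<Delta>) \<Longrightarrow> rule_instance L CS (Some v)
    [{#Rel w v#} + \<Gamma> \<turnstile> \<Delta>]
    (\<Gamma> \<turnstile> \<Delta>)"
| EBang: "j4 \<in> L \<Longrightarrow> rule_instance L CS None
    [{#Ev w (Bang t) (Just t A), Ev w t A#} + \<Gamma> \<turnstile> \<Delta>]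
    ({#Ev w t A#} + \<Gamma> \<turnstile> \<Delta>)"
| Mon: "j4 \<in> L \<Longrightarrow> rule_instance L CS None
    [{#Ev v t A, Ev w t A, Rel w v#} + \<Gamma> \<turnstile> \<Delta>]
    ({#Ev w t A, Rel w v#} + \<Gamma> \<turnstile> \<Delta>)"
| Trans: "j4 \<in> L \<Longrightarrow> rule_instance L CS None
    [{#Rel w u, Rel w v, Rel v u#} + \<Gamma> \<turnstile> \<Delta>]
    ({#Rel w v, Rel v u#} + \<Gamma> \<turnstile> \<Delta>)"
| EBarQuest: "jB \<in> L \<Longrightarrow> rule_instance L CS None
    [{#Forces w A#} + \<Gamma> \<turnstile> \<Delta>, {#Ev w (BarQuest t) (Neg (Just t A))#} + \<Gamma> \<turnstile> \<Delta>]
    (\<Gamma> \<turnstile> \<Delta>)"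
| Sym: "jB \<in> L \<Longrightarrow> rule_instance L CS None
    [{#Rel v w, Rel w v#} + \<Gamma> \<turnstile> \<Delta>]
    ({#Rel w v#} + \<Gamma> \<turnstile> \<Delta>)"
| SE: "j5 \<in> L \<Longrightarrow> rule_instance L CS None
    [{#Forces w (Just t A), Ev w t A#} + \<Gamma> \<turnstile> \<Delta>]
    ({#Ev w t A#} + \<Gamma> \<turnstile> \<Delta>)"
| EQuest: "j5 \<in> L \<Longrightarrow> rule_instance L CS None
    [{#Ev w t A#} + \<Gamma> \<turnstile> \<Delta>, {#Ev w (Quest t) (Neg (Just t A))#} + \<Gamma> \<turnstile> \<Delta>]
    (\<Gamma> \<turnstile> \<Delta>)"

text \<open>Each node of a derivation tree carries the eigenlabel (if any) of the rule instance applied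
  there, its conclusion, and the subderivations of its premises.\<close>

datatype ('p, 'x, 'c) deriv =
  Node "label option" (endsequent: "('p, 'x, 'c) sequent") "('p, 'x, 'c) deriv list"

fun derivation :: "scheme set \<Rightarrow> ('p, 'x, 'c) fm set \<Rightarrow> ('p, 'x, 'c) deriv \<Rightarrow> bool" where
  "derivation L CS (Node e S ds) \<longleftrightarrow>
     lang_seq L S \<and> rule_instance L CS e (map endsequent ds) S \<and> (\<forall>d\<in>set ds. derivation L CS d)"

definition derivable :: "scheme set \<Rightarrow> ('p, 'x, 'c) fm set \<Rightarrow> ('p, 'x, 'c) sequent \<Rightarrow> bool" where
  "derivable L CS S \<longleftrightarrow> (\<exists>d. derivation L CS d \<and> endsequent d = S)"


section \<open>The sublabel property\<close>

definition sublabel_instance ::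
  "label option \<Rightarrow> ('p, 'x, 'c) sequent list \<Rightarrow> ('p, 'x, 'c) sequent \<Rightarrow> bool" where
  "sublabel_instance e Ps S \<longleftrightarrow> (\<forall>P\<in>set Ps. labels_seq P \<subseteq> set_option e \<union> labels_seq S)"

fun sublabel_derivation :: "('p, 'x, 'c) deriv \<Rightarrow> bool" where
  "sublabel_derivation (Node e S ds) \<longleftrightarrow>
     sublabel_instance e (map endsequent ds) S \<and> (\<forall>d\<in>set ds. sublabel_derivation d)"

fun eigenlabels :: "('p, 'x, 'c) deriv \<Rightarrow> label set" where
  "eigenlabels (Node e S ds) = set_option e \<union> (\<Union>d\<in>set ds. eigenlabels d)"

fun labels_deriv :: "('p, 'x, 'c) deriv \<Rightarrow> label set" where
  "labels_deriv (Node e S ds) = labels_seq S \<union> (\<Union>d\<in>set ds. labels_deriv d)"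

end

theory Submission
  imports Defs
begin

text \<open>A derivation may be renamed along an arbitrary function \<open>f\<close> on labels, from the root upwards.
  A rule instance stays a rule instance under \<open>f\<close> as long as \<open>f\<close> keeps its eigenlabel away
  from the labels of its conclusion. At each node the values of \<open>f\<close> outside the conclusion can be
  chosen anew, because they do not change the conclusion: the eigenlabel goes to a fresh label and
  every other label that is missing from the conclusion goes to a fixed label of the conclusion.
  After this choice the instance has the sublabel property, and the induction hypothesis, stated for
  all renamings, treats the premises. Identifying labels can make a label of the conclusion
  coincide with an old eigenlabel; the new choice at each node repairs this at the same time.

  The choice needs a label in the conclusion, so the sequent without labels, which is the empty
  one, must be underivable. This holds because the calculus is sound for the one-world reflexive model
  in which \<open>t : A\<close> has the truth value of \<open>A\<close> and \<open>t\<close> is evidence for exactly the true formulas: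
  it makes all axiom instances, and hence all of a constant specification, true.\<close>

section \<open>Underivability of the empty sequent\<close>

text \<open>Truth of the formula obtained by erasing all terms, with every propositional variable true.\<close>

fun erasure_true :: "('p, 'x, 'c) fm \<Rightarrow> bool" where
  "erasure_true (PVar p) \<longleftrightarrow> True"
| "erasure_true Bot \<longleftrightarrow> False"
| "erasure_true (Neg A) \<longleftrightarrow> \<not> erasure_true A"
| "erasure_true (Conj A B) \<longleftrightarrow> erasure_true A \<and> erasure_true B"
| "erasure_true (Disj A B) \<longleftrightarrow> erasure_true A \<or> erasure_true B"
| "erasure_true (Imp A B) \<longleftrightarrow> (erasure_true A \<longrightarrow> erasure_true B)"
| "erasure_true (Just t A) \<longleftrightarrow> erasure_true A"

lemma tval_erasure_true: "tval erasure_true A \<longleftrightarrow> erasure_true A"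
  by (induction A) auto

lemma scheme_instance_erasure_true: "scheme_instance L A \<Longrightarrow> erasure_true A"
proof (induction rule: scheme_instance.induct)
  case (1 A)
  then show ?case
    unfolding tautology_def by (metis tval_erasure_true)
qed auto

lemma erasure_true_const_prefix: "erasure_true (const_prefix cs A) \<longleftrightarrow> erasure_true A"
  by (induction cs) (auto simp: const_prefix_def)

lemma constant_specification_erasure_true:
  assumes "constant_specification L CS" and "F \<in> CS"
  shows "erasure_true F"
  using assms
  by (fastforce simp: constant_specification_def axiom_instance_def erasure_true_const_prefix
      dest: scheme_instance_erasure_true split: if_splits)

fun lfm_true :: "('p, 'x, 'c) lfm \<Rightarrow> bool" where
  "lfm_true (Forces w A) \<longleftrightarrow> erasure_true A"
| "lfm_true (Rel w v) \<longleftrightarrow> True"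
| "lfm_true (Ev w t A) \<longleftrightarrow> erasure_true A"

fun seq_true :: "('p, 'x, 'c) sequent \<Rightarrow> bool" where
  "seq_true (\<Gamma> \<turnstile> \<Delta>) \<longleftrightarrow> (\<forall>\<phi>\<in>#\<Gamma>. lfm_true \<phi>) \<longrightarrow> (\<exists>\<phi>\<in>#\<Delta>. lfm_true \<phi>)"

text \<open>The rules (R:) and (Ser) are sound because their new world is the only world again. The two
  branching rules without principal formula are sound because \<open>\<not> t : A\<close> has the value opposite to
  that of \<open>A\<close>, so one of their two side formulas is true.\<close>

lemma rule_instance_sound:
  assumes "rule_instance L CS e Ps S" and "constant_specification L CS" and "\<forall>P\<in>set Ps. seq_true P"
  shows "seq_true S"
  using assms
proof (induction rule: rule_instance.induct)
  case (AN c F \<Gamma> \<Delta>)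
  then have "erasure_true F"
    using constant_specification_erasure_true by fastforce
  with AN show ?case by simp
qed auto

lemma derivation_sound:
  assumes "constant_specification L CS" and "derivation L CS d"
  shows "seq_true (endsequent d)"
  using assms(2)
proof (induction d)
  case (Node e S ds)
  then have "\<forall>P\<in>set (map endsequent ds). seq_true P"
    by auto
  with Node.prems show ?case
    using rule_instance_sound[OF _ assms(1)] by auto
qed

lemma labels_lfm_nonempty: "labels_lfm \<phi> \<noteq> {}"
  by (cases \<phi>) auto

lemma labels_endsequent_nonempty:
  assumes "constant_specification L CS" and "derivation L CS d"
  shows "labels_seq (endsequent d) \<noteq> {}"
proof
  obtain \<Gamma> \<Delta> where S: "endsequent d = (\<Gamma> \<turnstile> \<Delta>)"
    by (cases "endsequent d")
  assume "labels_seq (endsequent d) = {}"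
  then have "set_mset \<Gamma> = {}" and "set_mset \<Delta> = {}"
    by (simp_all add: S labels_lfm_nonempty)
  with derivation_sound[OF assms] show False
    by (simp add: S)
qed


section \<open>Renaming of labels\<close>

fun rename_lfm :: "(label \<Rightarrow> label) \<Rightarrow> ('p, 'x, 'c) lfm \<Rightarrow> ('p, 'x, 'c) lfm" where
  "rename_lfm f (Forces w A) = Forces (f w) A"
| "rename_lfm f (Rel w v) = Rel (f w) (f v)"
| "rename_lfm f (Ev w t A) = Ev (f w) t A"

fun rename_seq :: "(label \<Rightarrow> label) \<Rightarrow> ('p, 'x, 'c) sequent \<Rightarrow> ('p, 'x, 'c) sequent" where
  "rename_seq f (\<Gamma> \<turnstile> \<Delta>) = (image_mset (rename_lfm f) \<Gamma> \<turnstile> image_mset (rename_lfm f) \<Delta>)"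

lemma labels_rename_lfm: "labels_lfm (rename_lfm f \<phi>) = f ` labels_lfm \<phi>"
  by (cases \<phi>) auto

lemma labels_rename_seq: "labels_seq (rename_seq f S) = f ` labels_seq S"
  by (cases S) (simp add: labels_rename_lfm image_Un image_UN)

lemma lang_rename_lfm: "lang_lfm L (rename_lfm f \<phi>) = lang_lfm L \<phi>"
  by (cases \<phi>) auto

lemma lang_rename_seq: "lang_seq L (rename_seq f S) = lang_seq L S"
  by (cases S) (auto simp: lang_rename_lfm ball_Un)

lemma rename_lfm_cong: "(\<And>x. x \<in> labels_lfm \<phi> \<Longrightarrow> f x = g x) \<Longrightarrow> rename_lfm f \<phi> = rename_lfm g \<phi>"
  by (cases \<phi>) auto

lemma rename_seq_cong:
  assumes "\<And>x. x \<in> labels_seq S \<Longrightarrow> f x = g x"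
  shows "rename_seq f S = rename_seq g S"
  using assms by (cases S) (auto intro!: image_mset_cong rename_lfm_cong)

lemma rename_lfm_id: "rename_lfm id = id"
proof
  show "rename_lfm id \<phi> = id \<phi>" for \<phi> :: "('p, 'x, 'c) lfm"
    by (cases \<phi>) auto
qed

lemma rename_seq_id: "rename_seq id S = S"
  by (cases S) (simp add: rename_lfm_id)

lemma finite_labels_lfm: "finite (labels_lfm \<phi>)"
  by (cases \<phi>) auto

lemma finite_labels_seq: "finite (labels_seq S)"
  by (cases S) (simp add: finite_labels_lfm)

text \<open>Only (R:) and (Ser) require labels to be distinct, so \<open>f\<close> may identify labels as long as it
  respects their side condition.\<close>

lemma rule_instance_rename:
  assumes "rule_instance L CS e Ps S"
    and "\<And>v. e = Some v \<Longrightarrow> f v \<notin> f ` labels_seq S"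
  shows "rule_instance L CS (map_option f e) (map (rename_seq f) Ps) (rename_seq f S)"
  using assms
proof (induction rule: rule_instance.induct)
  case (RJust v w t A \<Gamma> \<Delta>)
  then show ?case
    using rule_instance.RJust[of "f v" "f w" t A "image_mset (rename_lfm f) \<Gamma>"
        "image_mset (rename_lfm f) \<Delta>" L CS]
    by (simp add: labels_rename_lfm image_Un image_UN)
next
  case (Ser v \<Gamma> \<Delta> w)
  then show ?case
    using rule_instance.Ser[of L "f v" "image_mset (rename_lfm f) \<Gamma>"
        "image_mset (rename_lfm f) \<Delta>" CS "f w"]
    by (simp add: labels_rename_lfm image_Un image_UN)
qed (auto intro: rule_instance.intros[simplified])


section \<open>Derivations with the sublabel property\<close>

lemma sublabel_renaming_exists:
  assumes inst: "rule_instance L CS e Ps S" and nonempty: "labels_seq S \<noteq> {}"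
  shows "\<exists>g. rename_seq g S = rename_seq f S
    \<and> rule_instance L CS (map_option g e) (map (rename_seq g) Ps) (rename_seq f S)
    \<and> sublabel_instance (map_option g e) (map (rename_seq g) Ps) (rename_seq f S)"
proof -
  obtain k where k: "k \<in> f ` labels_seq S"
    using nonempty by auto
  obtain z where z: "z \<notin> f ` labels_seq S"
    using ex_new_if_finite[OF infinite_UNIV_nat] finite_labels_seq by blast
  define g where
    "g x = (if x \<in> labels_seq S then f x else if e = Some x then z else k)" for x
  have S: "rename_seq g S = rename_seq f S"
    by (rule rename_seq_cong) (simp add: g_def)
  have img: "g ` labels_seq S = f ` labels_seq S"
    by (simp add: g_def)
  have "g v \<notin> g ` labels_seq S" if "e = Some v" for v
  proof -
    have "v \<notin> labels_seq S"
      using inst that by cases auto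
    then show ?thesis
      unfolding img using that z by (simp add: g_def)
  qed
  then have "rule_instance L CS (map_option g e) (map (rename_seq g) Ps) (rename_seq g S)"
    by (rule rule_instance_rename[OF inst])
  moreover have "g x \<in> set_option (map_option g e) \<union> f ` labels_seq S" for x
    using k by (auto simp: g_def)
  then have "sublabel_instance (map_option g e) (map (rename_seq g) Ps) (rename_seq f S)"
    by (auto simp: sublabel_instance_def labels_rename_seq)
  ultimately show ?thesis
    using S by auto
qed

text \<open>The statement for all renamings is what makes the induction work: the premises are
  renamed differently from the conclusion. The identity renaming gives the result of interest.\<close>

lemma sublabel_derivation_rename:
  assumes CS: "constant_specification L CS" and "derivation L CS d"
  shows "\<exists>d'. derivation L CS d' \<and> endsequent d' = rename_seq f (endsequent d)
    \<and> sublabel_derivation d'"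
  using assms(2)
proof (induction d arbitrary: f)
  case (Node e S ds)
  let ?Ps = "map endsequent ds"
  have inst: "rule_instance L CS e ?Ps S" and lang: "lang_seq L S"
    using Node.prems by auto
  have "labels_seq S \<noteq> {}"
    using labels_endsequent_nonempty[OF CS Node.prems] by simp
  from sublabel_renaming_exists[OF inst this]
  obtain g where g: "rule_instance L CS (map_option g e) (map (rename_seq g) ?Ps) (rename_seq f S)"
    "sublabel_instance (map_option g e) (map (rename_seq g) ?Ps) (rename_seq f S)"
    by blast
  have "\<forall>d\<in>set ds. \<exists>d'. derivation L CS d' \<and> endsequent d' = rename_seq g (endsequent d)
      \<and> sublabel_derivation d'"
    using Node by auto
  then obtain h where h: "\<And>d. d \<in> set ds \<Longrightarrow> derivation L CS (h d)
      \<and> endsequent (h d) = rename_seq g (endsequent d) \<and> sublabel_derivation (h d)"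
    by metis
  have "map endsequent (map h ds) = map (rename_seq g) ?Ps"
    using h by simp
  then have "derivation L CS (Node (map_option g e) (rename_seq f S) (map h ds))"
    and "sublabel_derivation (Node (map_option g e) (rename_seq f S) (map h ds))"
    using g h lang by (auto simp: lang_rename_seq simp del: map_map)
  then show ?case
    by fastforce
qed

lemma sublabel_derivation_labels:
  "sublabel_derivation d \<Longrightarrow> labels_deriv d \<subseteq> eigenlabels d \<union> labels_seq (endsequent d)"
proof (induction d)
  case (Node e S ds)
  have sub: "sublabel_derivation d" "labels_seq (endsequent d) \<subseteq> set_option e \<union> labels_seq S"
    if "d \<in> set ds" for d
    using Node.prems that unfolding sublabel_derivation.simps sublabel_instance_def set_map by blast+
  have "labels_deriv d \<subseteq> set_option e \<union> eigenlabels d \<union> labels_seq S" if "d \<in> set ds" for d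
    using Node.IH[OF that sub(1)[OF that]] sub(2)[OF that] by blast
  then have "(\<Union>d\<in>set ds. labels_deriv d) \<subseteq> set_option e \<union> (\<Union>d\<in>set ds. eigenlabels d) \<union> labels_seq S"
    by blast
  then show ?case
    unfolding labels_deriv.simps eigenlabels.simps deriv.sel by blast
qed

theorem proposition6p3:
  fixes L :: "scheme set"
    and CS :: "('p, 'x, 'c) fm set"
    and \<Gamma> \<Delta> :: "('p, 'x, 'c) lfm multiset"
  assumes "justification_logic L"
    and "constant_specification L CS"
    and "derivable L CS (\<Gamma> \<turnstile> \<Delta>)"
  shows "\<exists>d. derivation L CS d \<and> endsequent d = (\<Gamma> \<turnstile> \<Delta>) \<and> sublabel_derivation d
             \<and> labels_deriv d \<subseteq> eigenlabels d \<union> labels_seq (\<Gamma> \<turnstile> \<Delta>)"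
proof -
  obtain d where "derivation L CS d" "endsequent d = (\<Gamma> \<turnstile> \<Delta>)"
    using assms(3) by (auto simp: derivable_def)
  then obtain d' where "derivation L CS d'" "endsequent d' = (\<Gamma> \<turnstile> \<Delta>)" "sublabel_derivation d'"
    using sublabel_derivation_rename[OF assms(2), of d id] unfolding rename_seq_id by auto
  then show ?thesis
    using sublabel_derivation_labels[of d'] by auto
qed

end
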